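(* Let $\Delta$ be a (simplicial) triangulation of a 2-sphere. Then the Stanley-Reisner ideal of $\mathrm{sd}_4(\Delta)$ is generated in degree 2. Viewing this ideal as the edge ideal $I_G$ of a graph $G$, the complement graph $G^c$ (which is the 1-skeleton of $\mathrm{sd}_4(\Delta)$) is $C_4$-free, i.e. has no induced 4-cycle.
   Context: Let $\Delta$ be a pure 2-dimensional simplicial complex. The complex $\mathrm{sd}_4(\Delta)$ is obtained by subdividing every facet as follows. Each edge $\{u,v\}$ of $\Delta$ is subdivided by one new vertex $m_{uv}$ (shared by all facets containing that edge). In each facet $\{p,q,s\}$ three further new interior vertices $a_p,a_q,a_s$ (specific to that facet) are added, and the facet is replaced by the ten triangles $\{a_p,a_q,a_s\}$; $\{p,a_p,m_{pq}\}$, $\{p,a_p,m_{ps}\}$, $\{q,a_q,m_{pq}\}$, $\{q,a_q,m_{qs}\}$, $\{s,a_s,m_{ps}\}$, $\{s,a_s,m_{qs}\}$; $\{a_p,a_q,m_{pq}\}$, $\{a_q,a_s,m_{qs}\}$, $\{a_p,a_s,m_{ps}\}$. The edge ideal of a graph $G$ is the ideal generated by the products $x_ix_j$ over edges $\{i,j\}$ of $G$, in a polynomial ring over a field with one variable per vertex. *)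

theory Defs
  imports "HOL-Analysis.Analysis" "HOL-Library.Poly_Mapping" "HOL-Library.Ramsey" "HOL-Algebra.Ideal"
begin

definition abstract_simplicial_complex :: "'v set set \<Rightarrow> bool" where
  "abstract_simplicial_complex K \<longleftrightarrow>
     finite K \<and> {} \<in> K \<and> (\<forall>\<sigma>\<in>K. finite \<sigma>) \<and> (\<forall>\<sigma>\<in>K. \<forall>\<tau>. \<tau> \<subseteq> \<sigma> \<longrightarrow> \<tau> \<in> K)"

definition vertices :: "'v set set \<Rightarrow> 'v set" where
  "vertices K = \<Union>K"

definition facets :: "'v set set \<Rightarrow> 'v set set" where
  "facets K = {F \<in> K. \<forall>\<sigma>\<in>K. F \<subseteq> \<sigma> \<longrightarrow> \<sigma> = F}"

text \<open>
  The geometric realization, in barycentric coordinates. Its topology is that of a subspace of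
  the product space \<^typ>\<open>'v \<Rightarrow> real\<close>; for a finite complex this is the usual topology.
\<close>
definition geometric_realization :: "'v set set \<Rightarrow> ('v \<Rightarrow> real) set" where
  "geometric_realization K =
     {x. (\<forall>v. 0 \<le> x v) \<and> {v. x v \<noteq> 0} \<in> K \<and> (\<Sum>v | x v \<noteq> 0. x v) = 1}"

definition triangulates_2_sphere :: "'v set set \<Rightarrow> bool" where
  "triangulates_2_sphere K \<longleftrightarrow>
     abstract_simplicial_complex K \<and>
     geometric_realization K homeomorphic sphere (0 :: real ^ 3) 1"

definition complex_generated_by :: "'v set set \<Rightarrow> 'v set set" where
  "complex_generated_by T = insert {} {\<sigma>. \<exists>\<tau>\<in>T. \<sigma> \<subseteq> \<tau>}"

text \<open>
  \<open>Mid {u, v}\<close> is the new vertex on the edge \<open>{u, v}\<close>, shared by all facets containing that edge;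
  \<open>Inner F p\<close> is the new vertex in the interior of the facet \<open>F\<close> that belongs to its corner \<open>p\<close>.
\<close>
datatype 'v sd_vertex = Old 'v | Mid "'v set" | Inner "'v set" 'v

definition sd4_triangles :: "'v \<Rightarrow> 'v \<Rightarrow> 'v \<Rightarrow> 'v sd_vertex set set" where
  "sd4_triangles p q s = (let a = Inner {p, q, s}; m = (\<lambda>u v. Mid {u, v}) in
     {{a p, a q, a s},
      {Old p, a p, m p q}, {Old p, a p, m p s},
      {Old q, a q, m p q}, {Old q, a q, m q s},
      {Old s, a s, m p s}, {Old s, a s, m q s},
      {a p, a q, m p q}, {a q, a s, m q s}, {a p, a s, m p s}})"

text \<open>
  Meant for pure 2-dimensional complexes, such as triangulations of a 2-sphere, where every facet
  has exactly three vertices.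
\<close>
definition sd4 :: "'v set set \<Rightarrow> 'v sd_vertex set set" where
  "sd4 K = complex_generated_by
     (\<Union>{sd4_triangles p q s | p q s. {p, q, s} \<in> facets K \<and> distinct [p, q, s]})"

definition simple_graph :: "'v set \<times> 'v set set \<Rightarrow> bool" where
  "simple_graph G \<longleftrightarrow> finite (fst G) \<and> snd G \<subseteq> nsets (fst G) 2"

definition complement_graph :: "'v set \<times> 'v set set \<Rightarrow> 'v set \<times> 'v set set" where
  "complement_graph G = (fst G, nsets (fst G) 2 - snd G)"

definition one_skeleton :: "'v set set \<Rightarrow> 'v set \<times> 'v set set" where
  "one_skeleton K = (vertices K, {\<sigma> \<in> K. card \<sigma> = 2})"

definition C4_free :: "'v set \<times> 'v set set \<Rightarrow> bool" where
  "C4_free G \<longleftrightarrow>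
     \<not> (\<exists>a b c d. {a, b, c, d} \<subseteq> fst G \<and> distinct [a, b, c, d] \<and>
          {a, b} \<in> snd G \<and> {b, c} \<in> snd G \<and> {c, d} \<in> snd G \<and> {d, a} \<in> snd G \<and>
          {a, c} \<notin> snd G \<and> {b, d} \<notin> snd G)"

text \<open>
  A polynomial is a finitely supported function from exponent vectors to coefficients. The ring
  \<open>poly_ring V\<close> has one variable for each element of \<open>V\<close>, not for each element of the type \<open>'v\<close>.
\<close>
type_synonym ('v, 'k) mpolynomial = "('v \<Rightarrow>\<^sub>0 nat) \<Rightarrow>\<^sub>0 'k"

definition poly_ring :: "'v set \<Rightarrow> ('v, 'k::field) mpolynomial ring" where
  "poly_ring V =
     \<lparr>carrier = {p. \<forall>m\<in>Poly_Mapping.keys p. Poly_Mapping.keys m \<subseteq> V},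
      mult = (*), one = 1, zero = 0, add = (+)\<rparr>"

definition var :: "'v \<Rightarrow> ('v, 'k::field) mpolynomial" where
  "var v = Poly_Mapping.single (Poly_Mapping.single v 1) 1"

definition homogeneous :: "nat \<Rightarrow> ('v, 'k::field) mpolynomial \<Rightarrow> bool" where
  "homogeneous d p \<longleftrightarrow>
     (\<forall>m\<in>Poly_Mapping.keys p. (\<Sum>v\<in>Poly_Mapping.keys m. Poly_Mapping.lookup m v) = d)"

definition generated_in_degree :: "nat \<Rightarrow> 'v set \<Rightarrow> ('v, 'k::field) mpolynomial set \<Rightarrow> bool" where
  "generated_in_degree d V I \<longleftrightarrow>
     (\<exists>S \<subseteq> carrier (poly_ring V). (\<forall>p\<in>S. homogeneous d p) \<and> I = genideal (poly_ring V) S)"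

definition stanley_reisner_ideal :: "'v set set \<Rightarrow> ('v, 'k::field) mpolynomial set" where
  "stanley_reisner_ideal K =
     genideal (poly_ring (vertices K)) {\<Prod>v\<in>\<sigma>. var v | \<sigma>. \<sigma> \<subseteq> vertices K \<and> \<sigma> \<notin> K}"

definition edge_ideal :: "'v set \<times> 'v set set \<Rightarrow> ('v, 'k::field) mpolynomial set" where
  "edge_ideal G = genideal (poly_ring (fst G)) {var i * var j | i j. {i, j} \<in> snd G}"

lemma cring_poly_ring: "cring (poly_ring V :: ('v, 'k::field) mpolynomial ring)"
proof (rule cringI)
  let ?R = "poly_ring V :: ('v, 'k) mpolynomial ring"
  have add_closed: "x + y \<in> carrier ?R" if "x \<in> carrier ?R" "y \<in> carrier ?R" for x y
    using that Poly_Mapping.keys_add[of x y] unfolding poly_ring_def by auto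
  have mult_closed: "x * y \<in> carrier ?R" if "x \<in> carrier ?R" "y \<in> carrier ?R" for x y
  proof -
    have "Poly_Mapping.keys m \<subseteq> V" if m: "m \<in> Poly_Mapping.keys (x * y)" for m
    proof -
      obtain a b where ab: "m = a + b" "a \<in> Poly_Mapping.keys x" "b \<in> Poly_Mapping.keys y"
        using m Poly_Mapping.keys_mult[of x y] by blast
      then have "Poly_Mapping.keys a \<subseteq> V" "Poly_Mapping.keys b \<subseteq> V"
        using \<open>x \<in> carrier ?R\<close> \<open>y \<in> carrier ?R\<close> by (simp_all add: poly_ring_def)
      then show ?thesis
        using Poly_Mapping.keys_add[of a b] ab(1) by blast
    qed
    then show ?thesis by (simp add: poly_ring_def)
  qed
  have one_closed: "1 \<in> carrier ?R" and zero_closed: "0 \<in> carrier ?R"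
    by (simp_all add: poly_ring_def)
  have uminus_closed: "- x \<in> carrier ?R" if "x \<in> carrier ?R" for x
    using that by (simp add: poly_ring_def)
  have ops: "mult ?R = (*)" "one ?R = 1" "zero ?R = 0" "add ?R = (+)"
    by (simp_all add: poly_ring_def)
  show "abelian_group ?R"
  proof (rule abelian_groupI)
    fix x assume "x \<in> carrier ?R"
    then show "\<exists>y\<in>carrier ?R. y \<oplus>\<^bsub>?R\<^esub> x = \<zero>\<^bsub>?R\<^esub>"
      by (intro bexI[of _ "- x"] uminus_closed) (simp_all add: ops)
  qed (simp_all add: ops add_closed zero_closed add.assoc add.commute)
  show "comm_monoid ?R"
    by (rule comm_monoidI) (simp_all add: ops mult_closed one_closed mult.assoc mult.commute)
  show "(x \<oplus>\<^bsub>?R\<^esub> y) \<otimes>\<^bsub>?R\<^esub> z = x \<otimes>\<^bsub>?R\<^esub> z \<oplus>\<^bsub>?R\<^esub> y \<otimes>\<^bsub>?R\<^esub> z" for x y z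
    by (simp add: ops distrib_right)
qed

end

theory Submission
  imports Defs
begin

text \<open>
  The topology of the sphere plays no role: for every finite complex, each clique in the 1-skeleton
  of \<open>sd\<^sub>4\<close> is a face, so that the minimal non-faces are the non-edges, and the common neighbours
  of two non-adjacent vertices are pairwise adjacent, so that there is no induced 4-cycle. The graph
  is recovered from its edge ideal because every monomial of a polynomial in that ideal is divisible
  by some \<open>x\<^sub>i x\<^sub>j\<close> with \<open>{i, j}\<close> an edge.
\<close>

section \<open>Combinatorics of the subdivision\<close>

text \<open>These are the sets \<open>{p, q, s}\<close> over which \<open>sd4\<close> ranges, freed
  from any ordering of the corners.\<close>

definition triangles :: "'v set set \<Rightarrow> 'v set set" where
  "triangles K = {F \<in> facets K. card F = 3}"

text \<open>Edge relation of the 1-skeleton, with \<open>T\<close> standing for the set of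
  triangles. Splitting by constructors lets simplification decide each pair of vertex kinds.
  \<open>Mid\<close> and \<open>Inner\<close> accept arbitrary labels, so the side conditions single
  out those that really occur.\<close>

fun sd4_adj :: "'v set set \<Rightarrow> 'v sd_vertex \<Rightarrow> 'v sd_vertex \<Rightarrow> bool" where
  "sd4_adj T (Old p) (Old q) \<longleftrightarrow> False"
| "sd4_adj T (Mid e) (Mid e') \<longleftrightarrow> False"
| "sd4_adj T (Inner F p) (Inner G q) \<longleftrightarrow> F = G \<and> F \<in> T \<and> p \<in> F \<and> q \<in> F \<and> p \<noteq> q"
| "sd4_adj T (Old p) (Mid e) \<longleftrightarrow> (\<exists>F\<in>T. e \<subseteq> F) \<and> card e = 2 \<and> p \<in> e"
| "sd4_adj T (Mid e) (Old p) \<longleftrightarrow> (\<exists>F\<in>T. e \<subseteq> F) \<and> card e = 2 \<and> p \<in> e"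
| "sd4_adj T (Old p) (Inner F q) \<longleftrightarrow> p = q \<and> F \<in> T \<and> p \<in> F"
| "sd4_adj T (Inner F q) (Old p) \<longleftrightarrow> p = q \<and> F \<in> T \<and> p \<in> F"
| "sd4_adj T (Mid e) (Inner F p) \<longleftrightarrow> F \<in> T \<and> e \<subseteq> F \<and> card e = 2 \<and> p \<in> e"
| "sd4_adj T (Inner F p) (Mid e) \<longleftrightarrow> F \<in> T \<and> e \<subseteq> F \<and> card e = 2 \<and> p \<in> e"

lemma sd4_adj_sym: "sd4_adj T x y \<longleftrightarrow> sd4_adj T y x"
  by (cases x; cases y) auto

text \<open>Symmetric form of the list of ten triangles: the six ordered pairs of distinct corners
  give the six corner triangles once each and the three side triangles twice each.\<close>

lemma in_sd4_triangles_iff: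
  assumes "distinct [p, q, s]" "F = {p, q, s}"
  shows "\<tau> \<in> sd4_triangles p q s \<longleftrightarrow>
    \<tau> = Inner F ` F \<or>
    (\<exists>u\<in>F. \<exists>v\<in>F. u \<noteq> v \<and>
      (\<tau> = {Old u, Inner F u, Mid {u, v}} \<or> \<tau> = {Inner F u, Inner F v, Mid {u, v}}))"
proof -
  have "\<tau> \<in> sd4_triangles p q s \<longleftrightarrow>
    \<tau> = {Inner F p, Inner F q, Inner F s} \<or>
    \<tau> = {Old p, Inner F p, Mid {p, q}} \<or> \<tau> = {Old p, Inner F p, Mid {p, s}} \<or>
    \<tau> = {Old q, Inner F q, Mid {p, q}} \<or> \<tau> = {Old q, Inner F q, Mid {q, s}} \<or>
    \<tau> = {Old s, Inner F s, Mid {p, s}} \<or> \<tau> = {Old s, Inner F s, Mid {q, s}} \<or>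
    \<tau> = {Inner F p, Inner F q, Mid {p, q}} \<or> \<tau> = {Inner F q, Inner F s, Mid {q, s}} \<or>
    \<tau> = {Inner F p, Inner F s, Mid {p, s}}"
    by (simp add: sd4_triangles_def Let_def assms(2))
  moreover have "Inner F ` F = {Inner F p, Inner F q, Inner F s}"
    by (auto simp: assms(2))
  moreover have "(\<exists>u\<in>F. \<exists>v\<in>F. u \<noteq> v \<and> P u v) \<longleftrightarrow>
      P p q \<or> P p s \<or> P q p \<or> P q s \<or> P s p \<or> P s q" for P
    using assms by auto
  \<comment> \<open>Both orders of a pair are oriented alike, so that what remains is propositional
    in the equations for \<open>\<tau>\<close>.\<close>
  moreover have "{q, p} = {p, q}" "{s, p} = {p, s}" "{s, q} = {q, s}"
    "{Inner F q, Inner F p, m} = {Inner F p, Inner F q, m}"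
    "{Inner F s, Inner F p, m} = {Inner F p, Inner F s, m}"
    "{Inner F s, Inner F q, m} = {Inner F q, Inner F s, m}" for m
    by (rule insert_commute)+
  ultimately show ?thesis
    by (simp only:) argo
qed

lemma sd4_iff:
  "\<sigma> \<in> sd4 K \<longleftrightarrow> \<sigma> = {} \<or> (\<exists>F\<in>triangles K.
    \<sigma> \<subseteq> Inner F ` F \<or>
    (\<exists>u\<in>F. \<exists>v\<in>F. u \<noteq> v \<and>
      (\<sigma> \<subseteq> {Old u, Inner F u, Mid {u, v}} \<or> \<sigma> \<subseteq> {Inner F u, Inner F v, Mid {u, v}})))"
proof -
  define P where "P F \<longleftrightarrow> \<sigma> \<subseteq> Inner F ` F \<or> (\<exists>u\<in>F. \<exists>v\<in>F. u \<noteq> v \<and>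
      (\<sigma> \<subseteq> {Old u, Inner F u, Mid {u, v}} \<or> \<sigma> \<subseteq> {Inner F u, Inner F v, Mid {u, v}}))" for F
  \<comment> \<open>One-point rule that eliminates the maximal triangle \<open>\<tau>\<close> above
    \<open>\<sigma>\<close>, stated for abstract families of sets.\<close>
  have one_point: "(\<exists>\<tau>. (\<tau> = A \<or> (\<exists>u\<in>F. \<exists>v\<in>F. u \<noteq> v \<and> (\<tau> = B u v \<or> \<tau> = C u v))) \<and> Q \<tau>) \<longleftrightarrow>
      Q A \<or> (\<exists>u\<in>F. \<exists>v\<in>F. u \<noteq> v \<and> (Q (B u v) \<or> Q (C u v)))"
    for Q A B C and F :: "'a set" by auto
  have faces: "(\<exists>\<tau>\<in>sd4_triangles p q s. \<sigma> \<subseteq> \<tau>) \<longleftrightarrow> P F"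
    if "distinct [p, q, s]" "F = {p, q, s}" for p q s F
    unfolding Bex_def[of "sd4_triangles p q s"] in_sd4_triangles_iff[OF that] P_def
    by (rule one_point)
  have T: "F \<in> triangles K \<longleftrightarrow>
      (\<exists>p q s. F = {p, q, s} \<and> {p, q, s} \<in> facets K \<and> distinct [p, q, s])" for F
    unfolding triangles_def by (auto simp: card_3_iff)
  have "\<sigma> \<in> sd4 K \<longleftrightarrow> \<sigma> = {} \<or>
      (\<exists>p q s. {p, q, s} \<in> facets K \<and> distinct [p, q, s] \<and> (\<exists>\<tau>\<in>sd4_triangles p q s. \<sigma> \<subseteq> \<tau>))"
    unfolding sd4_def complex_generated_by_def by blast
  also have "\<dots> \<longleftrightarrow> \<sigma> = {} \<or>
      (\<exists>p q s. {p, q, s} \<in> facets K \<and> distinct [p, q, s] \<and> P {p, q, s})"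
    by (intro disj_cong refl iff_exI conj_cong faces)
  also have "\<dots> \<longleftrightarrow> \<sigma> = {} \<or> (\<exists>F\<in>triangles K. P F)"
    unfolding Bex_def T by blast
  finally show ?thesis unfolding P_def .
qed

section \<open>The three kinds of triangles as faces\<close>

lemma complex_generated_by_subset:
  "\<sigma> \<in> complex_generated_by T \<Longrightarrow> \<tau> \<subseteq> \<sigma> \<Longrightarrow> \<tau> \<in> complex_generated_by T"
  unfolding complex_generated_by_def by blast

lemma sd4_subset: "\<sigma> \<in> sd4 K \<Longrightarrow> \<tau> \<subseteq> \<sigma> \<Longrightarrow> \<tau> \<in> sd4 K"
  unfolding sd4_def by (rule complex_generated_by_subset)

lemma corner_triangle:
  assumes "F \<in> triangles K" "u \<in> F" "v \<in> F" "u \<noteq> v"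
  shows "{Old u, Inner F u, Mid {u, v}} \<in> sd4 K"
  unfolding sd4_iff using assms by (intro disjI2 bexI[of _ F] bexI[of _ u] bexI[of _ v]) auto

lemma side_triangle:
  assumes "F \<in> triangles K" "u \<in> F" "v \<in> F" "u \<noteq> v"
  shows "{Inner F u, Inner F v, Mid {u, v}} \<in> sd4 K"
  unfolding sd4_iff using assms by (intro disjI2 bexI[of _ F] bexI[of _ u] bexI[of _ v]) auto

lemma central_triangle:
  assumes "F \<in> triangles K"
  shows "Inner F ` F \<in> sd4 K"
  unfolding sd4_iff using assms by (intro disjI2 bexI[of _ F] disjI1 subset_refl)

lemma card_triangle: "F \<in> triangles K \<Longrightarrow> card F = 3"
  by (simp add: triangles_def)

lemma triangle_other_vertex:
  assumes "F \<in> triangles K"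
  obtains q where "q \<in> F" "q \<noteq> p"
proof -
  have "\<not> F \<subseteq> {p}"
    using card_triangle[OF assms] card_mono[of "{p}" F] by auto
  then show ?thesis using that by blast
qed

section \<open>Vertices, edges and cliques of the subdivision\<close>

lemma vertices_sd4_iff: "x \<in> vertices (sd4 K) \<longleftrightarrow> {x} \<in> sd4 K"
proof
  assume "x \<in> vertices (sd4 K)"
  then obtain \<sigma> where "\<sigma> \<in> sd4 K" "x \<in> \<sigma>" unfolding vertices_def by (elim UnionE)
  then show "{x} \<in> sd4 K" by (intro sd4_subset[of \<sigma> K "{x}"]) simp_all
next
  assume "{x} \<in> sd4 K"
  then show "x \<in> vertices (sd4 K)" unfolding vertices_def by (rule UnionI) simp
qed

lemma Inner_vertex: "Inner F p \<in> vertices (sd4 K) \<Longrightarrow> F \<in> triangles K \<and> p \<in> F"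
  unfolding vertices_sd4_iff sd4_iff by auto

text \<open>Two vertices of one of the ten triangles always have a shape accepted by
  \<open>sd4_adj\<close>; conversely every accepted pair lies in a corner triangle or in the central
  one. Equal vertices are excluded because a singleton can be a face while \<open>sd4_adj\<close> is
  irreflexive.\<close>

lemma pair_in_sd4_iff:
  assumes "x \<noteq> y"
  shows "{x, y} \<in> sd4 K \<longleftrightarrow> sd4_adj (triangles K) x y"
proof
  assume "{x, y} \<in> sd4 K"
  then show "sd4_adj (triangles K) x y"
    using assms unfolding sd4_iff by (auto simp: insert_commute)
next
  have edge: "\<exists>v\<in>F. v \<noteq> p \<and> e = {p, v}" if "card e = 2" "p \<in> e" "e \<subseteq> F" for e p and F :: "'a set"
  proof -
    obtain v where "e = {p, v}" "v \<noteq> p"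
      using \<open>card e = 2\<close> \<open>p \<in> e\<close> by (auto simp: card_2_iff)
    then show ?thesis using \<open>e \<subseteq> F\<close> by auto
  qed
  have corner: "{Old p, Inner F p} \<in> sd4 K" if F: "F \<in> triangles K" "p \<in> F" for F p
  proof -
    obtain v where "v \<in> F" "v \<noteq> p" using triangle_other_vertex[OF F(1)] .
    then show ?thesis using F by (intro sd4_subset[OF corner_triangle[of F K p v]]) auto
  qed
  \<comment> \<open>One corner triangle serves both pairs, with \<open>v\<close> the other end of
    \<open>e\<close>.\<close>
  have mid: "{Old p, Mid e} \<in> sd4 K" "{Inner F p, Mid e} \<in> sd4 K"
    if F: "F \<in> triangles K" "e \<subseteq> F" "card e = 2" "p \<in> e" for F e p
  proof -
    obtain v where v: "v \<in> F" "v \<noteq> p" "e = {p, v}" using edge[OF F(3,4,2)] by blast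
    then have "{Old p, Inner F p, Mid e} \<in> sd4 K"
      using corner_triangle[of F K p v] F by auto
    then show "{Old p, Mid e} \<in> sd4 K" "{Inner F p, Mid e} \<in> sd4 K"
      by (rule sd4_subset, simp)+
  qed
  have inner: "{Inner F p, Inner F q} \<in> sd4 K" if "F \<in> triangles K" "p \<in> F" "q \<in> F" for F p q
    using that by (intro sd4_subset[OF central_triangle[of F K]]) auto
  show "{x, y} \<in> sd4 K" if "sd4_adj (triangles K) x y"
    using that mid corner inner by (cases x; cases y) (auto simp: insert_commute)
qed

text \<open>A clique has at most one \<open>Old\<close> vertex, at most one \<open>Mid\<close>
  vertex, and \<open>Inner\<close> vertices of one facet only. Which kinds occur determines a face
  that contains the whole clique.\<close>

lemma sd4_flag:
  assumes V: "\<sigma> \<subseteq> vertices (sd4 K)"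
    and clique: "\<And>x y. x \<in> \<sigma> \<Longrightarrow> y \<in> \<sigma> \<Longrightarrow> x \<noteq> y \<Longrightarrow> {x, y} \<in> sd4 K"
  shows "\<sigma> \<in> sd4 K"
proof -
  have adj: "sd4_adj (triangles K) x y" if "x \<in> \<sigma>" "y \<in> \<sigma>" "x \<noteq> y" for x y
    using clique[OF that] pair_in_sd4_iff[OF that(3)] by blast
  have inner: "F = G" if "Inner F p \<in> \<sigma>" "Inner G q \<in> \<sigma>" for F G p q
    using adj[OF that] by auto
  have singleton: "\<sigma> \<in> sd4 K" if "\<sigma> \<subseteq> {x}" for x
    using that V vertices_sd4_iff[of x K] sd4_iff[of "{}" K] by (auto simp: subset_singleton_iff)
  consider (old_no_inner) p where "Old p \<in> \<sigma>" "\<And>F q. Inner F q \<notin> \<sigma>"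
    | (no_inner) "\<And>p. Old p \<notin> \<sigma>" "\<And>F q. Inner F q \<notin> \<sigma>"
    | (old_inner) p F q where "Old p \<in> \<sigma>" "Inner F q \<in> \<sigma>"
    | (mid_inner) e F q where "\<And>p. Old p \<notin> \<sigma>" "Mid e \<in> \<sigma>" "Inner F q \<in> \<sigma>"
    | (only_inner) F q where "\<And>p. Old p \<notin> \<sigma>" "\<And>e. Mid e \<notin> \<sigma>" "Inner F q \<in> \<sigma>"
    by metis
  then show ?thesis
  proof cases
    case old_no_inner
    show ?thesis
    proof (cases "\<exists>e. Mid e \<in> \<sigma>")
      case True
      then obtain e where e: "Mid e \<in> \<sigma>" by blast
      have "\<sigma> \<subseteq> {Old p, Mid e}"
      proof
        fix x assume "x \<in> \<sigma>"
        then show "x \<in> {Old p, Mid e}"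
          using old_no_inner adj[of x "Old p"] adj[of x "Mid e"] e by (cases x) auto
      qed
      then show ?thesis
        using sd4_subset[OF clique[OF old_no_inner(1) e]] by simp
    next
      case False
      have "\<sigma> \<subseteq> {Old p}"
      proof
        fix x assume "x \<in> \<sigma>"
        then show "x \<in> {Old p}"
          using old_no_inner adj[of x "Old p"] False by (cases x) auto
      qed
      then show ?thesis by (rule singleton)
    qed
  next
    case no_inner
    have mid: "\<exists>e. x = Mid e" if "x \<in> \<sigma>" for x
      using that no_inner by (cases x) auto
    have "x = y" if "x \<in> \<sigma>" "y \<in> \<sigma>" for x y
      using mid[OF that(1)] mid[OF that(2)] adj[OF that] by fastforce
    \<comment> \<open>The choice operator names the only possible element and also covers empty
      \<open>\<sigma>\<close>.\<close>
    then have "\<sigma> \<subseteq> {SOME x. x \<in> \<sigma>}"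
      by (metis someI singleton_iff subsetI)
    then show ?thesis by (rule singleton)
  next
    case old_inner
    have F: "F \<in> triangles K" "p \<in> F" "q = p" using adj[OF old_inner] by auto
    \<comment> \<open>The vertex \<open>v\<close> is the other end of \<open>e\<close> if some
      \<open>Mid e\<close> occurs. Otherwise any second corner of \<open>F\<close> will do, since
      the last condition is then vacuous.\<close>
    obtain v where v: "v \<in> F" "v \<noteq> p" "\<And>e. Mid e \<in> \<sigma> \<Longrightarrow> e = {p, v}"
    proof (cases "\<exists>e. Mid e \<in> \<sigma>")
      case True
      then obtain e where e: "Mid e \<in> \<sigma>" by blast
      have "e \<subseteq> F" "card e = 2" "p \<in> e"
        using adj[OF e old_inner(2)] F(3) by auto
      then obtain v where "v \<in> F" "v \<noteq> p" "e = {p, v}"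
        by (auto simp: card_2_iff)
      moreover have "e' = e" if "Mid e' \<in> \<sigma>" for e'
        using adj[OF that e] by auto
      ultimately show ?thesis using that by blast
    next
      case False
      then show ?thesis using triangle_other_vertex[OF F(1)] that by blast
    qed
    have "\<sigma> \<subseteq> {Old p, Inner F p, Mid {p, v}}"
    proof
      fix x assume "x \<in> \<sigma>"
      then show "x \<in> {Old p, Inner F p, Mid {p, v}}"
        using adj[of x "Old p"] old_inner(1) inner[OF old_inner(2), of _ p] v(3) by (cases x) auto
    qed
    then show ?thesis using sd4_subset corner_triangle[OF F(1,2) v(1)] v(2) by blast
  next
    case mid_inner
    have F: "F \<in> triangles K" "e \<subseteq> F" "card e = 2"
      using adj[OF mid_inner(2,3)] by auto
    then obtain u v where uv: "u \<in> F" "v \<in> F" "u \<noteq> v" "e = {u, v}"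
      by (auto simp: card_2_iff)
    \<comment> \<open>Adjacency to \<open>Mid e\<close> forces the corner of each
      \<open>Inner\<close> vertex into \<open>e\<close>, which leaves only \<open>u\<close> and
      \<open>v\<close>.\<close>
    have "\<sigma> \<subseteq> {Inner F u, Inner F v, Mid {u, v}}"
    proof
      fix x assume "x \<in> \<sigma>"
      then show "x \<in> {Inner F u, Inner F v, Mid {u, v}}"
        using adj[of x "Mid e"] mid_inner(1,2) inner[OF mid_inner(3)] uv(4) by (cases x) auto
    qed
    then show ?thesis using sd4_subset side_triangle[OF F(1) uv(1-3)] by blast
  next
    case only_inner
    have "\<sigma> \<subseteq> Inner F ` F"
    proof
      fix x assume x: "x \<in> \<sigma>"
      then obtain G r where G: "x = Inner G r" using only_inner by (cases x) auto
      then have "G = F" using inner only_inner x by blast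
      \<comment> \<open>A one-element clique has no adjacency to exploit, so
        \<open>r \<in> F\<close> is drawn from \<open>V\<close>.\<close>
      then show "x \<in> Inner F ` F" using Inner_vertex[of F r K] V x G by auto
    qed
    moreover have "F \<in> triangles K" using Inner_vertex[of F q K] only_inner(3) V by blast
    ultimately show ?thesis using sd4_subset central_triangle by blast
  qed
qed

text \<open>Two triangles that share two different edges are equal, and so are two edges that share two
  different vertices. This leaves two non-adjacent vertices at most two common neighbours, such as
  \<open>Old p\<close> and \<open>Inner {p, q, r} p\<close> for \<open>Mid {p, q}\<close> and \<open>Mid {p, r}\<close>, and these are adjacent.\<close>

lemma common_neighbours_adj:
  assumes T: "\<And>F. F \<in> T \<Longrightarrow> card F = 3"
    and "\<not> sd4_adj T a c" "a \<noteq> c" "b \<noteq> d"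
    and ab: "sd4_adj T a b" and cb: "sd4_adj T c b" and ad: "sd4_adj T a d" and cd: "sd4_adj T c d"
  shows "sd4_adj T b d"
proof -
  \<comment> \<open>Two different 2-element sets have a union of at least three elements, which
    fills any 3-element set that contains both.\<close>
  have edges: "F = G" if "F \<in> T" "G \<in> T" "e \<subseteq> F" "e \<subseteq> G" "e' \<subseteq> F" "e' \<subseteq> G"
    "card e = 2" "card e' = 2" "e \<noteq> e'" for F G e e'
  proof -
    have fin: "finite F" "finite G" using T that by (auto intro: card_ge_0_finite)
    have "finite e" using that(7) by (auto intro: card_ge_0_finite)
    have "\<not> e' \<subseteq> e"
      using that(7-9) \<open>finite e\<close> card_subset_eq[of e e'] by metis
    then have "e \<subset> e \<union> e'" by blast
    then have "2 < card (e \<union> e')"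
      using psubset_card_mono[of "e \<union> e'" e] that fin by (metis finite_Un finite_subset)
    then have "card (e \<union> e') \<ge> 3" by simp
    moreover have "e \<union> e' \<subseteq> F" "e \<union> e' \<subseteq> G" using that by auto
    ultimately have "e \<union> e' = F" "e \<union> e' = G"
      using fin T that by (simp_all add: card_seteq)
    then show ?thesis by simp
  qed
  have uniq: "e = e'"
    if "card e = 2" "card e' = 2" "u \<in> e" "v \<in> e" "u \<in> e'" "v \<in> e'" "u \<noteq> v"
    for e e' and u v :: 'a
    using that by (auto simp: card_2_iff)
  note nbrs = assms(2-)
  show ?thesis
  proof (cases a)
    case a: (Old p)
    show ?thesis
    proof (cases c)
      \<comment> \<open>Two distinct corners have at most one common neighbour, the midpoint of the
        edge they span.\<close>
      case c: (Old q)
      then show ?thesis using nbrs a by (cases b; cases d; simp) (metis uniq subsetD)+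
    next
      \<comment> \<open>A common neighbour would be some \<open>Inner F p\<close> with
        \<open>p \<in> e \<subseteq> F\<close>, which makes \<open>a\<close> and \<open>c\<close>
        adjacent.\<close>
      case c: (Mid e)
      then show ?thesis using nbrs a by (cases b; cases d) auto
    next
      \<comment> \<open>Here \<open>x \<noteq> p\<close>, and the only candidates are
        \<open>Mid {p, x}\<close> and \<open>Inner F p\<close>, which are adjacent.\<close>
      case c: (Inner F x)
      then show ?thesis using nbrs a by (cases b; cases d; simp) (metis uniq subsetD)+
    qed
  next
    case a: (Mid e)
    show ?thesis
    proof (cases c)
      case c: (Old q)
      then show ?thesis using nbrs a by (cases b; cases d) auto
    next
      case c: (Mid e')
      have e: "card e = 2" "card e' = 2" "e \<noteq> e'"
        using nbrs a c by (cases b; simp)+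
      have vertex: "u = v" if "u \<in> e" "u \<in> e'" "v \<in> e" "v \<in> e'" for u v
        using uniq[OF e(1,2)] e(3) that by metis
      have triangle: "F = G"
        if "F \<in> T" "G \<in> T" "e \<subseteq> F" "e \<subseteq> G" "e' \<subseteq> F" "e' \<subseteq> G" for F G
        using edges[OF that e] .
      show ?thesis
      proof (cases b; cases d)
        \<comment> \<open>Both neighbours lie over the one vertex shared by \<open>e\<close> and
          \<open>e'\<close>, in the one triangle containing both edges; so \<open>b = d\<close>, a
          contradiction.\<close>
        fix F p G q assume bd: "b = Inner F p" "d = Inner G q"
        have "p = q" "F = G"
          using nbrs a c bd vertex[of p q] triangle[of F G] by simp_all
        then show ?thesis using nbrs bd by simp
      qed (use nbrs a c in \<open>auto dest: vertex\<close>)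
    next
      case c: (Inner F x)
      then show ?thesis using nbrs a by (cases b; cases d) auto
    qed
  next
    case a: (Inner F x)
    show ?thesis
    proof (cases c)
      case c: (Old q)
      then show ?thesis using nbrs a by (cases b; cases d; simp) (metis uniq subsetD)+
    next
      case c: (Mid e)
      then show ?thesis using nbrs a by (cases b; cases d) auto
    next
      case c: (Inner G y)
      show ?thesis
      proof (cases b; cases d)
        fix e e' assume bd: "b = Mid e" "d = Mid e'"
        have *: "F \<in> T" "G \<in> T" "e \<subseteq> F" "e \<subseteq> G" "e' \<subseteq> F" "e' \<subseteq> G" "card e = 2" "card e' = 2"
            "e \<noteq> e'" "x \<in> e" "y \<in> e"
          using nbrs a c bd by auto
        \<comment> \<open>Two common midpoints force \<open>F = G\<close>, and then \<open>a\<close>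
          and \<open>c\<close> are equal or adjacent, a contradiction.\<close>
        then have "F = G" by (intro edges[of F G e e'])
        then show ?thesis using nbrs a c * by auto
      qed (use nbrs a c in auto)
    qed
  qed
qed


section \<open>Finiteness and induced 4-cycles\<close>

lemma finite_vertices_sd4:
  assumes "finite (triangles K)"
  shows "finite (vertices (sd4 K))"
proof (rule finite_subset)
  show "vertices (sd4 K) \<subseteq> (\<Union>F\<in>triangles K. Old ` F \<union> Mid ` Pow F \<union> Inner F ` F)"
  proof
    fix x assume "x \<in> vertices (sd4 K)"
    then obtain F where "F \<in> triangles K" "x \<in> Inner F ` F \<or> (\<exists>u\<in>F. \<exists>v\<in>F.
        x \<in> {Old u, Inner F u, Mid {u, v}} \<or> x \<in> {Inner F u, Inner F v, Mid {u, v}})"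
      unfolding vertices_sd4_iff sd4_iff by auto
    then show "x \<in> (\<Union>F\<in>triangles K. Old ` F \<union> Mid ` Pow F \<union> Inner F ` F)"
      by (intro UN_I[of F]) auto
  qed
  have "finite F" if "F \<in> triangles K" for F
    using card_triangle[OF that] by (auto intro: card_ge_0_finite)
  then show "finite (\<Union>F\<in>triangles K. Old ` F \<union> Mid ` Pow F \<union> Inner F ` F)"
    using assms by auto
qed

text \<open>In an induced 4-cycle \<open>b\<close> and \<open>d\<close> would be common neighbours
  of the non-adjacent \<open>a\<close> and \<open>c\<close>, hence adjacent themselves.\<close>

lemma C4_free_one_skeleton_sd4: "C4_free (one_skeleton (sd4 K))"
  unfolding C4_free_def
proof (intro notI, elim exE conjE)
  let ?E = "snd (one_skeleton (sd4 K))"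
  have edge: "{x, y} \<in> ?E \<longleftrightarrow> sd4_adj (triangles K) x y" if "x \<noteq> y" for x y
    using that by (simp add: one_skeleton_def pair_in_sd4_iff)
  fix a b c d
  assume "distinct [a, b, c, d]" "{a, b} \<in> ?E" "{b, c} \<in> ?E" "{c, d} \<in> ?E" "{d, a} \<in> ?E"
    "{a, c} \<notin> ?E" "{b, d} \<notin> ?E"
  then have "sd4_adj (triangles K) a b" "sd4_adj (triangles K) b c" "sd4_adj (triangles K) c d"
    "sd4_adj (triangles K) d a" "\<not> sd4_adj (triangles K) a c" "\<not> sd4_adj (triangles K) b d"
    "a \<noteq> c" "b \<noteq> d"
    using edge by auto
  then show False
    using common_neighbours_adj[of "triangles K" a c b d] card_triangle sd4_adj_sym by metis
qed

section \<open>Squarefree quadratic monomial ideals\<close>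

lemma poly_ring_simps [simp]:
  "mult (poly_ring V) = (*)" "one (poly_ring V) = 1" "zero (poly_ring V) = 0"
  "add (poly_ring V) = (+)"
  by (simp_all add: poly_ring_def)

lemma var_in_carrier: "v \<in> V \<Longrightarrow> var v \<in> carrier (poly_ring V)"
  by (simp add: poly_ring_def var_def)

lemma mult_in_carrier:
  "p \<in> carrier (poly_ring V) \<Longrightarrow> q \<in> carrier (poly_ring V) \<Longrightarrow> p * q \<in> carrier (poly_ring V)"
  using monoid.m_closed[OF ring.is_monoid[OF cring.axioms(1)[OF cring_poly_ring]], of p V q] by simp

lemma prod_var_in_carrier: "\<sigma> \<subseteq> V \<Longrightarrow> (\<Prod>v\<in>\<sigma>. var v) \<in> carrier (poly_ring V)"
proof (induction \<sigma> rule: infinite_finite_induct)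
  case (insert v \<sigma>)
  then show ?case by (simp add: mult_in_carrier var_in_carrier)
qed (simp_all add: poly_ring_def)

lemma var_mult_var:
  "var i * var j = Poly_Mapping.single (Poly_Mapping.single i 1 + Poly_Mapping.single j 1) 1"
  by (simp add: var_def mult_single)

lemma keys_add_single_single:
  "Poly_Mapping.keys (Poly_Mapping.single i 1 + Poly_Mapping.single j (1::nat)) = {i, j}"
  by (auto simp: in_keys_iff lookup_add lookup_single when_def split: if_splits)

lemma homogeneous_var_mult_var:
  assumes "i \<noteq> j"
  shows "homogeneous 2 (var i * var j)"
  using assms unfolding homogeneous_def var_mult_var
  by (simp add: keys_add_single_single[unfolded One_nat_def] lookup_add lookup_single)

text \<open>Serves as an upper bound for the edge ideal with explicit membership. Multiplication by
  a polynomial only enlarges the supports of monomials, so each still contains a member of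
  \<open>E\<close>.\<close>

lemma ideal_monomials_containing_edge:
  "ideal {p \<in> carrier (poly_ring V). \<forall>m\<in>Poly_Mapping.keys p. \<exists>e\<in>E. e \<subseteq> Poly_Mapping.keys m}
    (poly_ring V :: ('v, 'k::field) mpolynomial ring)"
  (is "ideal ?J ?R")
proof -
  interpret cring ?R by (rule cring_poly_ring)
  \<comment> \<open>The inverse in the ring record is identified with negation of polynomials by
    uniqueness of inverses.\<close>
  have uminus: "\<ominus>\<^bsub>?R\<^esub> p = - p" if "p \<in> carrier ?R" for p
    using that by (intro minus_equality) (simp_all add: poly_ring_def)
  have closed: "x * p \<in> ?J" if p: "p \<in> ?J" and x: "x \<in> carrier ?R" for x p
  proof -
    have "\<exists>e\<in>E. e \<subseteq> Poly_Mapping.keys m" if "m \<in> Poly_Mapping.keys (x * p)" for m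
    proof -
      obtain a b where m: "m = a + b" and b: "b \<in> Poly_Mapping.keys p"
        using \<open>m \<in> Poly_Mapping.keys (x * p)\<close> Poly_Mapping.keys_mult[of x p] by blast
      \<comment> \<open>Exponents are natural numbers, so nothing cancels in
        \<open>a + b\<close>.\<close>
      have "Poly_Mapping.keys b \<subseteq> Poly_Mapping.keys m"
        by (auto simp: m in_keys_iff lookup_add)
      then show ?thesis using b p by blast
    qed
    then show ?thesis using p x mult_in_carrier by blast
  qed
  show ?thesis
  proof (rule idealI)
    show "ring ?R" by (rule ring_axioms)
    show "subgroup ?J (add_monoid ?R)"
    proof (rule subgroup.intro)
      show "?J \<subseteq> carrier (add_monoid ?R)" by auto
      show "x \<otimes>\<^bsub>add_monoid ?R\<^esub> y \<in> ?J" if "x \<in> ?J" "y \<in> ?J" for x y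
        using that a_closed[of x y] Poly_Mapping.keys_add[of x y] by auto
      show "\<one>\<^bsub>add_monoid ?R\<^esub> \<in> ?J" by (simp add: poly_ring_def)
      show "inv\<^bsub>add_monoid ?R\<^esub> x \<in> ?J" if "x \<in> ?J" for x
        using that uminus[of x] a_inv_closed[of x] by (simp add: a_inv_def)
    qed
    show "x \<otimes>\<^bsub>?R\<^esub> a \<in> ?J" "a \<otimes>\<^bsub>?R\<^esub> x \<in> ?J" if "a \<in> ?J" "x \<in> carrier ?R" for a x
      using closed[OF that] by (simp_all add: mult.commute)
  qed
qed

section \<open>Edge ideals and the graphs they determine\<close>

lemma edge_generators_in_carrier:
  assumes "simple_graph G"
  shows "{var i * var j | i j. {i, j} \<in> snd G} \<subseteq> carrier (poly_ring (fst G))"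
proof -
  have "{i, j} \<subseteq> fst G" if "{i, j} \<in> snd G" for i j
    using that assms unfolding simple_graph_def nsets_def by blast
  then show ?thesis by (auto intro!: mult_in_carrier var_in_carrier)
qed

text \<open>If the product lies in the ideal, the support \<open>{i, j}\<close> of its only monomial
  contains an edge; as an edge has two elements, it is \<open>{i, j}\<close> itself.\<close>

lemma var_mult_var_in_edge_ideal_iff:
  assumes G: "simple_graph G" and "i \<noteq> j"
  shows "(var i * var j :: ('v, 'k::field) mpolynomial) \<in> edge_ideal G \<longleftrightarrow> {i, j} \<in> snd G"
proof
  let ?R = "poly_ring (fst G) :: ('v, 'k) mpolynomial ring"
  interpret cring ?R by (rule cring_poly_ring)
  let ?S = "{var i * var j | i j. {i, j} \<in> snd G} :: ('v, 'k) mpolynomial set"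
  show "(var i * var j :: ('v, 'k) mpolynomial) \<in> edge_ideal G" if "{i, j} \<in> snd G"
    unfolding edge_ideal_def
    by (rule subsetD[OF genideal_self[OF edge_generators_in_carrier[OF G]]]) (use that in blast)
  let ?J = "{p \<in> carrier ?R. \<forall>m\<in>Poly_Mapping.keys p. \<exists>e\<in>snd G. e \<subseteq> Poly_Mapping.keys m}"
  have "?S \<subseteq> ?J"
  proof
    fix p assume p: "p \<in> ?S"
    then obtain i j where "p = var i * var j" "{i, j} \<in> snd G" by blast
    then have "\<forall>m\<in>Poly_Mapping.keys p. \<exists>e\<in>snd G. e \<subseteq> Poly_Mapping.keys m"
      by (auto simp: var_mult_var keys_add_single_single[unfolded One_nat_def]
          intro!: bexI[of _ "{i, j}"])
    then show "p \<in> ?J" using p edge_generators_in_carrier[OF G] by blast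
  qed
  then have "edge_ideal G \<subseteq> ?J"
    unfolding edge_ideal_def by (intro genideal_minimal ideal_monomials_containing_edge)
  moreover assume "(var i * var j :: ('v, 'k) mpolynomial) \<in> edge_ideal G"
  ultimately have "(var i * var j :: ('v, 'k) mpolynomial) \<in> ?J" by (rule subsetD)
  then obtain e where e: "e \<in> snd G" "e \<subseteq> {i, j}"
    by (auto simp: var_mult_var keys_add_single_single[unfolded One_nat_def])
  then have "card e = card {i, j}"
    using G \<open>i \<noteq> j\<close> by (auto simp: simple_graph_def nsets_def)
  then show "{i, j} \<in> snd G" using e card_subset_eq[of "{i, j}" e] by simp
qed

text \<open>The edges can be read off from the ideal by testing which products of two distinct
  variables it contains.\<close>

lemma edge_ideal_eq_imp_edges_eq:
  fixes G H :: "'v set \<times> 'v set set"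
  assumes "simple_graph G" "simple_graph H"
    and eq: "(edge_ideal G :: ('v, 'k::field) mpolynomial set) = edge_ideal H"
  shows "snd G = snd H"
proof -
  have "e \<in> snd H" if "simple_graph G" "simple_graph H" "e \<in> snd G"
      and "(edge_ideal G :: ('v, 'k) mpolynomial set) = edge_ideal H" for G H :: "'v set \<times> 'v set set" and e
  proof -
    have "card e = 2" using that by (auto simp: simple_graph_def nsets_def)
    then obtain i j where "e = {i, j}" "i \<noteq> j" by (auto simp: card_2_iff)
    then show ?thesis
      using var_mult_var_in_edge_ideal_iff[where 'k = 'k, of G i j]
        var_mult_var_in_edge_ideal_iff[where 'k = 'k, of H i j] that by simp
  qed
  then show ?thesis using assms eq[symmetric] by blast
qed

lemma generated_in_degree_2_edge_ideal:
  fixes G :: "'v set \<times> 'v set set"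
  assumes "simple_graph G"
  shows "generated_in_degree 2 (fst G) (edge_ideal G :: ('v, 'k::field) mpolynomial set)"
proof -
  have distinct: "i \<noteq> j" if "{i, j} \<in> snd G" for i j
    using that assms by (auto simp: simple_graph_def nsets_def)
  define S where "S = {var i * var j :: ('v, 'k) mpolynomial | i j. {i, j} \<in> snd G}"
  have "S \<subseteq> carrier (poly_ring (fst G))"
    unfolding S_def by (rule edge_generators_in_carrier[OF assms])
  moreover have "\<forall>p\<in>S. homogeneous 2 p"
    unfolding S_def using distinct by (auto intro!: homogeneous_var_mult_var)
  moreover have "edge_ideal G = genideal (poly_ring (fst G)) S"
    unfolding S_def edge_ideal_def by (rule refl)
  ultimately show ?thesis
    unfolding generated_in_degree_def by blast
qed

text \<open>By \<open>flag\<close>, every non-face contains a non-edge \<open>{x, y}\<close>, so its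
  monomial is a multiple of \<open>var x * var y\<close>. Conversely, non-edges are non-faces, so
  their products are among the Stanley-Reisner generators.\<close>

lemma stanley_reisner_ideal_flag:
  fixes K :: "'v set set"
  assumes fin: "finite (vertices K)"
    and flag: "\<And>\<sigma>. \<sigma> \<subseteq> vertices K \<Longrightarrow>
      (\<And>x y. x \<in> \<sigma> \<Longrightarrow> y \<in> \<sigma> \<Longrightarrow> x \<noteq> y \<Longrightarrow> {x, y} \<in> K) \<Longrightarrow> \<sigma> \<in> K"
  shows "(stanley_reisner_ideal K :: ('v, 'k::field) mpolynomial set) =
    edge_ideal (complement_graph (one_skeleton K))"
proof -
  let ?V = "vertices K"
  let ?R = "poly_ring ?V :: ('v, 'k) mpolynomial ring"
  interpret cring ?R by (rule cring_poly_ring)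
  define S where "S = ({\<Prod>v\<in>\<sigma>. var v | \<sigma>. \<sigma> \<subseteq> ?V \<and> \<sigma> \<notin> K} :: ('v, 'k) mpolynomial set)"
  define E where "E = snd (complement_graph (one_skeleton K))"
  define S' where "S' = ({var i * var j | i j. {i, j} \<in> E} :: ('v, 'k) mpolynomial set)"
  have E: "{i, j} \<in> E \<longleftrightarrow> i \<in> ?V \<and> j \<in> ?V \<and> i \<noteq> j \<and> {i, j} \<notin> K" for i j
    by (auto simp: E_def complement_graph_def one_skeleton_def nsets_def card_insert_if)
  have S: "S \<subseteq> carrier ?R" and S': "S' \<subseteq> carrier ?R"
    by (auto simp: S_def S'_def E intro!: prod_var_in_carrier mult_in_carrier var_in_carrier)
  have "S' \<subseteq> S"
  proof
    fix p assume "p \<in> S'"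
    then obtain i j where p: "p = var i * var j" and ij: "i \<in> ?V" "j \<in> ?V" "i \<noteq> j" "{i, j} \<notin> K"
      by (auto simp: S'_def E)
    have "p = (\<Prod>v\<in>{i, j}. var v)" using p ij(3) by simp
    then show "p \<in> S" unfolding S_def using ij by blast
  qed
  moreover have "S \<subseteq> genideal ?R S'"
  proof
    fix p assume "p \<in> S"
    then obtain \<sigma> where p: "p = (\<Prod>v\<in>\<sigma>. var v)" and \<sigma>: "\<sigma> \<subseteq> ?V" "\<sigma> \<notin> K"
      by (auto simp: S_def)
    then obtain x y where xy: "x \<in> \<sigma>" "y \<in> \<sigma>" "x \<noteq> y" "{x, y} \<notin> K"
      using flag[OF \<sigma>(1)] by metis
    have "finite \<sigma>" using \<sigma> fin finite_subset by blast
    \<comment> \<open>Splitting off the non-edge exhibits \<open>p\<close> as a ring element times a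
      quadratic generator.\<close>
    then have "p = (\<Prod>v\<in>\<sigma> - {x, y}. var v) * (\<Prod>v\<in>{x, y}. var v)"
      using p xy prod.subset_diff[of "{x, y}" \<sigma> var] by blast
    then have "p = (\<Prod>v\<in>\<sigma> - {x, y}. var v) * (var x * var y)"
      using xy(3) by simp
    moreover have "var x * var y \<in> genideal ?R S'"
      using genideal_self[OF S'] xy \<sigma> E[of x y] unfolding S'_def by blast
    moreover have "(\<Prod>v\<in>\<sigma> - {x, y}. var v) \<in> carrier ?R"
      using \<sigma> by (intro prod_var_in_carrier) auto
    ultimately show "p \<in> genideal ?R S'"
      using ideal.I_l_closed[OF genideal_ideal[OF S']] by fastforce
  qed
  ultimately have "genideal ?R S = genideal ?R S'"
    using genideal_self[OF S] genideal_ideal[OF S] genideal_ideal[OF S']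
    by (intro equalityI genideal_minimal) auto
  then show ?thesis
    by (simp add: stanley_reisner_ideal_def edge_ideal_def S_def S'_def E_def
        complement_graph_def one_skeleton_def)
qed

lemma complement_graph_complement_graph:
  "snd G \<subseteq> nsets (fst G) 2 \<Longrightarrow> complement_graph (complement_graph G) = G"
  by (simp add: complement_graph_def double_diff prod_eq_iff)

theorem proposition6p5:
  fixes \<Delta> :: "'v set set"
    and I :: "('v sd_vertex, 'k::field) mpolynomial set"
  assumes "triangulates_2_sphere \<Delta>"
  defines "I \<equiv> stanley_reisner_ideal (sd4 \<Delta>)"
  shows "generated_in_degree 2 (vertices (sd4 \<Delta>)) I \<and>
         (\<exists>G. simple_graph G \<and> fst G = vertices (sd4 \<Delta>) \<and> I = edge_ideal G) \<and>
         (\<forall>G. simple_graph G \<and> fst G = vertices (sd4 \<Delta>) \<and> I = edge_ideal G \<longrightarrow>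
            complement_graph G = one_skeleton (sd4 \<Delta>) \<and> C4_free (complement_graph G))"
proof -
  let ?K = "sd4 \<Delta>"
  let ?H = "complement_graph (one_skeleton ?K)"
  have "finite \<Delta>"
    using assms(1) by (simp add: triangulates_2_sphere_def abstract_simplicial_complex_def)
  then have fin: "finite (vertices ?K)"
    by (intro finite_vertices_sd4) (simp add: triangles_def facets_def)
  have I: "I = edge_ideal ?H"
    unfolding I_def by (rule stanley_reisner_ideal_flag[OF fin sd4_flag])
  have fst_H: "fst ?H = vertices ?K"
    by (simp add: complement_graph_def one_skeleton_def)
  have H: "simple_graph ?H"
    using fin by (auto simp: simple_graph_def complement_graph_def one_skeleton_def)
  have "snd (one_skeleton ?K) \<subseteq> nsets (fst (one_skeleton ?K)) 2"
    by (auto simp: one_skeleton_def nsets_def vertices_def intro: card_ge_0_finite)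
  then have HH: "complement_graph ?H = one_skeleton ?K"
    by (rule complement_graph_complement_graph)
  \<comment> \<open>The conclusion speaks of every graph with edge ideal \<open>I\<close>, so each
    such graph must first be identified with \<open>?H\<close>.\<close>
  have unique: "G = ?H" if "simple_graph G" "fst G = vertices ?K" "I = edge_ideal G" for G
  proof -
    have "snd G = snd ?H"
      by (rule edge_ideal_eq_imp_edges_eq[OF that(1) H trans[OF that(3)[symmetric] I]])
    then show ?thesis using that(2) fst_H by (simp add: prod_eq_iff)
  qed
  show ?thesis
  proof (intro conjI allI impI)
    show "generated_in_degree 2 (vertices ?K) I"
      using generated_in_degree_2_edge_ideal[OF H] unfolding I fst_H .
    show "\<exists>G. simple_graph G \<and> fst G = vertices ?K \<and> I = edge_ideal G"
      using H fst_H I by blast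
    fix G assume "simple_graph G \<and> fst G = vertices ?K \<and> I = edge_ideal G"
    then have "G = ?H" using unique by blast
    then show "complement_graph G = one_skeleton ?K" by (simp add: HH)
    then show "C4_free (complement_graph G)" by (simp add: C4_free_one_skeleton_sd4)
  qed
qed

end
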